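(* Let $a\in\mathbb{R}$ and let $s_1,s_2\in\mathbb{C}$ with $\operatorname{Re}(s_1)>0$ and $\operatorname{Re}(s_2)>0$. Then $$J^{s_1}J^{s_2}=J^{s_1+s_2}=J^{s_2}J^{s_1},$$ that is, for every $f\in E$ and every $x>a$, $J^{s_1}(J^{s_2}(f))(x)=J^{s_1+s_2}(f)(x)=J^{s_2}(J^{s_1}(f))(x)$.
   Context: $E$ denotes the set of integrable and derivable causal functions $f$ on $I=\,]a,+\infty[$: complex-valued functions, differentiable on $]a,+\infty[$, integrable on $]a,x[$ for every $x>a$, and extended by $f(x)=0$ for $x\le a$. For $s\in\mathbb{C}$ with $\operatorname{Re}(s)>0$, the $s$-order integral operator is $$J^s(f)(x)=\frac{1}{\Gamma(s)}\int_a^x (x-y)^{s-1}f(y)\,dy,\qquad x>a,$$ where $\Gamma$ is Euler's gamma function; $J^{s_1}(J^{s_2}(f))$ is given by applying the same formula to the function $J^{s_2}(f)$. *)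

theory Defs
  imports "HOL-Analysis.Analysis"
begin

definition causal_space :: "real \<Rightarrow> (real \<Rightarrow> complex) set" where
  "causal_space a = {f. f differentiable_on {a<..} \<and>
     (\<forall>x>a. set_integrable lborel {a<..<x} f) \<and> (\<forall>x\<le>a. f x = 0)}"

text \<open>The domain of integration is empty for \<open>x \<le> a\<close>, so the value of the operator is a function
  on the whole real line that vanishes on \<open>{..a}\<close>, matching the causal extension of its argument.
  The base of the power is a positive real number there, so the principal branch of \<open>powr\<close> is
  the usual complex power of a positive real.\<close>

definition frac_int :: "real \<Rightarrow> complex \<Rightarrow> (real \<Rightarrow> complex) \<Rightarrow> real \<Rightarrow> complex" where
  "frac_int a s f x =
     1 / Gamma s * (LBINT y:{a<..<x}. complex_of_real (x - y) powr (s - 1) * f y)"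

end

theory Submission
  imports Defs
begin

text \<open>Extended by zero to the negative axis, the kernels \<open>k\<^sub>s(t) = t\<^bsup>s - 1\<^esup>\<close> satisfy
  \<open>k\<^sub>s * k\<^sub>r = B(s, r) k\<^bsub>s + r\<^esub>\<close> for some constant \<open>B(s, r)\<close>, by scaling, and Fubini's theorem
  transfers this to \<open>k\<^sub>s * (k\<^sub>r * g) = B(s, r) (k\<^bsub>s + r\<^esub> * g)\<close>. Since \<open>k\<^sub>s * exp = \<Gamma>(s) exp\<close>, the choice
  \<open>g = exp\<close> gives \<open>B(s, r) = \<Gamma>(s) \<Gamma>(r) / \<Gamma>(s + r)\<close>, and the choice \<open>g = f\<close> gives the theorem. Fubini
  applies to \<open>f\<close> because \<open>k\<^bsub>s + r\<^esub>(x - t) f(t)\<close> is integrable: away from \<open>t = x\<close> the kernel is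
  bounded, and near \<open>t = x\<close> the continuous function \<open>f\<close> is.\<close>

text \<open>The cutoff at \<open>0\<close> turns integrals over \<open>{a<..<x}\<close> into
  convolutions over the whole line. Writing the power with \<open>exp\<close> and \<open>ln\<close>
  reduces its laws to those of the real logarithm.\<close>

definition power_kernel :: "complex \<Rightarrow> real \<Rightarrow> complex" where
  "power_kernel s t = (if 0 < t then exp ((s - 1) * of_real (ln t)) else 0)"

lemma power_kernel_eq_powr: "0 < t \<Longrightarrow> power_kernel s t = complex_of_real t powr (s - 1)"
  by (simp add: power_kernel_def powr_def Ln_of_real)

lemma power_kernel_nonpos [simp]: "t \<le> 0 \<Longrightarrow> power_kernel s t = 0"
  by (simp add: power_kernel_def)

lemma measurable_power_kernel [measurable]: "power_kernel s \<in> borel_measurable borel"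
proof -
  have "(\<lambda>t. complex_of_real (ln t)) \<in> borel_measurable borel"
    by measurable
  then have "(\<lambda>t. (s - 1) * complex_of_real (ln t)) \<in> borel_measurable borel"
    by measurable
  then have "(\<lambda>t. exp ((s - 1) * complex_of_real (ln t))) \<in> borel_measurable borel"
    by (rule measurable_compose) (intro borel_measurable_continuous_onI continuous_intros)
  then show ?thesis
    unfolding power_kernel_def[abs_def] by measurable
qed

lemma norm_power_kernel: "norm (power_kernel s t) = (if 0 < t then t powr (Re s - 1) else 0)"
  by (simp add: power_kernel_def powr_def)

lemma power_kernel_1: "power_kernel 1 t = (if 0 < t then 1 else 0)"
  by (simp add: power_kernel_def)

lemma power_kernel_mult:
  assumes "0 < c"
  shows "power_kernel s (c * t) = power_kernel s c * power_kernel s t"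
proof -
  have "(0 < c * t) = (0 < t)"
    using assms by (simp add: zero_less_mult_iff)
  then show ?thesis
    using assms by (auto simp: power_kernel_def ln_mult ring_distribs simp flip: exp_add)
qed

text \<open>The extra factor \<open>c\<close> is the Jacobian of the scaling by \<open>c\<close>; it
  supplies the missing 1 in \<open>(s - 1) + (r - 1) + 1\<close>.\<close>

lemma power_kernel_add:
  assumes "0 < c"
  shows "of_real c * (power_kernel s c * power_kernel r c) = power_kernel (s + r) c"
proof -
  define l where "l = complex_of_real (ln c)"
  have "of_real c = exp l"
    using assms by (simp add: l_def exp_of_real)
  then have "of_real c * (exp ((s - 1) * l) * exp ((r - 1) * l)) = exp ((s + r - 1) * l)"
    by (simp add: algebra_simps flip: exp_add)
  then show ?thesis
    using assms by (simp add: power_kernel_def l_def)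
qed

section \<open>Convolution of power kernels\<close>

lemma integrable_power_kernel_beta:
  assumes "0 < Re s" "0 < Re r"
  shows "integrable lborel (\<lambda>u. power_kernel s (1 - u) * power_kernel r u)"
proof (rule Bochner_Integration.integrable_bound)
  show "integrable lborel
      (\<lambda>u. indicator {0..1} u *\<^sub>R (u powr (Re r - 1) * (1 - u) powr (Re s - 1)))"
    using integrable_Beta[OF assms(2,1)] by (simp add: set_integrable_def)
  show "AE u in lborel. norm (power_kernel s (1 - u) * power_kernel r u)
      \<le> norm (indicator {0..1} u *\<^sub>R (u powr (Re r - 1) * (1 - u) powr (Re s - 1)))"
    by (auto simp: norm_mult norm_power_kernel indicator_def)
qed measurable

text \<open>The substitution \<open>y = t + (x - t) * u\<close> maps the unit interval onto the
  interval from \<open>t\<close> to \<open>x\<close>; multiplicativity then pulls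
  \<open>x - t\<close> out of both kernels.\<close>

lemma power_kernel_conv_scale:
  assumes "t < x"
  shows "power_kernel s (x - (t + (x - t) * u)) * power_kernel r (t + (x - t) * u - t) =
    power_kernel s (x - t) * power_kernel r (x - t) * (power_kernel s (1 - u) * power_kernel r u)"
proof -
  have "x - (t + (x - t) * u) = (x - t) * (1 - u)"
    by (simp add: algebra_simps)
  then show ?thesis
    using assms by (simp add: power_kernel_mult)
qed

lemma power_kernel_conv_degenerate:
  "x \<le> t \<Longrightarrow> power_kernel s (x - y) * power_kernel r (y - t) = 0"
  by (cases "y < x") auto

lemma integrable_power_kernel_conv:
  assumes "0 < Re s" "0 < Re r"
  shows "integrable lborel (\<lambda>y. power_kernel s (x - y) * power_kernel r (y - t))"
proof (cases "t < x")
  case True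
  have "integrable lborel (\<lambda>u. power_kernel s (x - (t + (x - t) * u)) *
      power_kernel r (t + (x - t) * u - t))"
    unfolding power_kernel_conv_scale[OF True]
    by (intro integrable_mult_right integrable_power_kernel_beta assms)
  then show ?thesis
    using lborel_integrable_real_affine_iff[of "x - t"
        "\<lambda>y. power_kernel s (x - y) * power_kernel r (y - t)" t] True
    by simp
qed (simp add: power_kernel_conv_degenerate)

text \<open>Scaling reduces every pair \<open>t < x\<close> to the unit interval. Divergent
  integrals cause no exception, as both sides then take the default value 0.\<close>

lemma lborel_integral_power_kernel_conv:
  "(LBINT y. power_kernel s (x - y) * power_kernel r (y - t)) =
    (LBINT u. power_kernel s (1 - u) * power_kernel r u) * power_kernel (s + r) (x - t)"
proof (cases "t < x")
  case True
  have "(LBINT y. power_kernel s (x - y) * power_kernel r (y - t)) =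
      of_real (x - t) * (LBINT u. power_kernel s (x - (t + (x - t) * u)) *
        power_kernel r (t + (x - t) * u - t))"
    using True by (subst lborel_integral_real_affine[where c = "x - t" and t = t])
      (simp_all add: scaleR_conv_of_real)
  also have "\<dots> = of_real (x - t) * (power_kernel s (x - t) * power_kernel r (x - t)) *
      (LBINT u. power_kernel s (1 - u) * power_kernel r u)"
    unfolding power_kernel_conv_scale[OF True] by simp
  also have "of_real (x - t) * (power_kernel s (x - t) * power_kernel r (x - t)) =
      power_kernel (s + r) (x - t)"
    using True by (intro power_kernel_add) simp
  finally show ?thesis
    by (simp add: mult.commute)
qed (simp add: power_kernel_conv_degenerate)

lemma norm_power_kernel_eq_kernel:
  "of_real (norm (power_kernel s t)) = power_kernel (of_real (Re s)) t"
  by (simp add: power_kernel_def exp_of_real[symmetric] del: exp_of_real)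

text \<open>The norm of a kernel is the kernel of exponent \<open>Re s\<close>, so the scaling law
  for complex kernels also covers norms. This prepares the integrability test for Fubini.\<close>

lemma lborel_integral_norm_power_kernel_conv:
  "\<exists>C. \<forall>x t. (LBINT y. norm (power_kernel s (x - y) * power_kernel r (y - t))) =
    C * norm (power_kernel (s + r) (x - t))"
proof -
  define C where
    "C = (LBINT u. norm (power_kernel s (1 - u) * power_kernel r u))"
  have "(LBINT y. norm (power_kernel s (x - y) * power_kernel r (y - t))) =
      C * norm (power_kernel (s + r) (x - t))" for x t
  proof -
    have "complex_of_real (LBINT y. norm (power_kernel s (x - y) * power_kernel r (y - t))) =
        of_real (C * norm (power_kernel (s + r) (x - t)))"
      unfolding C_def
      using lborel_integral_power_kernel_conv[of "of_real (Re s)" x "of_real (Re r)" t]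
      by (simp add: norm_mult norm_power_kernel_eq_kernel
          flip: integral_complex_of_real)
    then show ?thesis
      by (simp only: of_real_eq_iff)
  qed
  then show ?thesis
    by blast
qed

lemma power_kernel_conv_assoc:
  fixes g :: "real \<Rightarrow> complex"
  assumes s: "0 < Re s" and r: "0 < Re r" and g [measurable]: "g \<in> borel_measurable borel"
    and int: "integrable lborel (\<lambda>t. power_kernel (s + r) (x - t) * g t)"
  shows "(LBINT y. power_kernel s (x - y) * (LBINT t. power_kernel r (y - t) * g t)) =
    (LBINT u. power_kernel s (1 - u) * power_kernel r u) *
    (LBINT t. power_kernel (s + r) (x - t) * g t)"
proof -
  define F where "F t y = power_kernel s (x - y) * power_kernel r (y - t) * g t" for t y
  obtain C where C: "(LBINT y. norm (power_kernel s (x - y) * power_kernel r (y - t))) =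
      C * norm (power_kernel (s + r) (x - t))" for t
    using lborel_integral_norm_power_kernel_conv by blast
  have "integrable (lborel \<Otimes>\<^sub>M lborel) (case_prod F)"
  proof (rule lborel_pair.Fubini_integrable)
    show "case_prod F \<in> borel_measurable (lborel \<Otimes>\<^sub>M lborel)"
      unfolding F_def case_prod_unfold by measurable
    \<comment> \<open>Integrating in \<open>y\<close> first collapses the two kernels into one, so
      integrability of the outer function is what \<open>int\<close> provides.\<close>
    have "(LBINT y. norm (F t y)) = C * norm (power_kernel (s + r) (x - t) * g t)" for t
    proof -
      have "(LBINT y. norm (F t y)) =
          (LBINT y. norm (power_kernel s (x - y) * power_kernel r (y - t)) * norm (g t))"
        by (simp add: F_def norm_mult)
      also have "\<dots> = C * norm (power_kernel (s + r) (x - t)) * norm (g t)"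
        using C by simp
      finally show ?thesis
        by (simp add: norm_mult)
    qed
    then show "integrable lborel (\<lambda>t. LBINT y. norm (case_prod F (t, y)))"
      using int by simp
    show "AE t in lborel. integrable lborel (\<lambda>y. case_prod F (t, y))"
      unfolding F_def case_prod_conv
      by (intro AE_I2 integrable_mult_left integrable_power_kernel_conv s r)
  qed
  then have "(LBINT y. LBINT t. F t y) = (LBINT t. LBINT y. F t y)"
    by (rule lborel_pair.Fubini_integral)
  moreover have "(LBINT t. F t y) =
      power_kernel s (x - y) * (LBINT t. power_kernel r (y - t) * g t)" for y
    by (simp add: F_def mult.assoc)
  moreover have "(LBINT y. F t y) = (LBINT u. power_kernel s (1 - u) * power_kernel r u) *
      (power_kernel (s + r) (x - t) * g t)" for t
  proof -
    have "(LBINT y. F t y) = (LBINT y. power_kernel s (x - y) * power_kernel r (y - t)) * g t"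
      by (simp add: F_def)
    then show ?thesis
      by (simp add: lborel_integral_power_kernel_conv mult.assoc)
  qed
  ultimately show ?thesis
    by simp
qed

text \<open>With \<open>u = x - t\<close> the integrand becomes \<open>exp x\<close> times Euler's
  integrand for \<open>Gamma s\<close>.\<close>

lemma has_bochner_integral_power_kernel_exp:
  assumes "0 < Re s"
  shows "has_bochner_integral lborel
    (\<lambda>t. power_kernel s (x - t) * of_real (exp t)) (Gamma s * of_real (exp x))"
proof -
  define h where "h u = power_kernel s u * of_real (exp (- u))" for u
  have h_eq: "h = (\<lambda>u. indicator {0<..} u *\<^sub>R (of_real u powr (s - 1) / of_real (exp u)))"
    by (auto simp: h_def fun_eq_iff power_kernel_eq_powr indicator_def exp_minus field_simps)
  have meas: "h \<in> borel_measurable borel"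
    unfolding h_def[abs_def] by measurable
  \<comment> \<open>Euler's integral is available for \<open>lebesgue\<close>; Borel measurability
    of \<open>h\<close> carries it over to \<open>lborel\<close>.\<close>
  have "integrable lebesgue h"
    using absolutely_integrable_Gamma_integral'[OF assms]
    by (simp add: h_eq set_integrable_def)
  then have int: "integrable lborel h"
    using meas by (simp add: integrable_completion)
  have "set_lebesgue_integral lebesgue {0<..}
      (\<lambda>u. of_real u powr (s - 1) / of_real (exp u)) = Gamma s"
    using set_lebesgue_integral_eq_integral(2)[OF absolutely_integrable_Gamma_integral'[OF assms]]
      Gamma_integral_complex'[OF assms] by (simp add: integral_unique)
  then have "integral\<^sup>L lebesgue h = Gamma s"
    by (simp add: h_eq set_lebesgue_integral_def)
  then have "has_bochner_integral lborel h (Gamma s)"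
    using int meas by (simp add: has_bochner_integral_iff integral_completion)
  then have "has_bochner_integral lborel (\<lambda>t. h (x - t)) (Gamma s)"
    using lborel_has_bochner_integral_real_affine_iff[of "-1" h "Gamma s" x] by simp
  then have "has_bochner_integral lborel (\<lambda>t. h (x - t) * of_real (exp x))
      (Gamma s * of_real (exp x))"
    by (rule has_bochner_integral_mult_left)
  moreover have "h (x - t) * of_real (exp x) = power_kernel s (x - t) * of_real (exp t)" for t
    by (simp add: h_def exp_diff field_simps flip: of_real_mult)
  ultimately show ?thesis
    by simp
qed

text \<open>\<open>Gamma\<close> takes the value 0 only at its poles, the nonpositive integers, and
  there only by convention.\<close>

lemma Gamma_nonzero_Re_pos:
  assumes "0 < Re s"
  shows "Gamma s \<noteq> 0"
proof
  assume "Gamma s = 0"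
  then obtain n where "s = of_int n" "n \<le> 0"
    by (auto simp: Gamma_eq_zero_iff elim!: nonpos_Ints_cases)
  with assms show False
    by simp
qed

lemma lborel_integral_power_kernel_beta:
  assumes s: "0 < Re s" and r: "0 < Re r"
  shows "(LBINT u. power_kernel s (1 - u) * power_kernel r u) = Beta s r"
proof -
  have sr: "0 < Re (s + r)"
    using s r by simp
  have E: "integrable lborel (\<lambda>t. power_kernel q (x - t) * of_real (exp t))"
    "(LBINT t. power_kernel q (x - t) * of_real (exp t)) = Gamma q * of_real (exp x)"
    if "0 < Re q" for q x
    using has_bochner_integral_power_kernel_exp[OF that, of x]
    by (auto simp: has_bochner_integral_iff)
  \<comment> \<open>Associativity for \<open>exp\<close> at the point \<open>0\<close>, where
    \<open>exp\<close> is 1, with the inner convolution already evaluated.\<close>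
  have "(LBINT y. power_kernel s (0 - y) * (Gamma r * of_real (exp y))) =
      (LBINT u. power_kernel s (1 - u) * power_kernel r u) * Gamma (s + r)"
    using power_kernel_conv_assoc[OF s r _ E(1)[OF sr], of 0] E(2)[OF sr, of 0] E(2)[OF r]
    by simp
  moreover have "(LBINT y. power_kernel s (0 - y) * (Gamma r * of_real (exp y))) =
      Gamma r * (LBINT y. power_kernel s (0 - y) * of_real (exp y))"
    by (simp add: mult.left_commute)
  moreover have "Gamma (s + r) \<noteq> 0"
    using sr by (rule Gamma_nonzero_Re_pos)
  ultimately show ?thesis
    using E(2)[OF s, of 0] by (simp add: Beta_def field_simps)
qed

section \<open>Fractional integrals of causal functions\<close>

lemma frac_int_eq_power_kernel:
  assumes "\<And>y. y \<le> a \<Longrightarrow> f y = 0"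
  shows "frac_int a s f x = 1 / Gamma s * (LBINT y. power_kernel s (x - y) * f y)"
proof -
  \<comment> \<open>To the left of the interval \<open>f\<close> vanishes, to the right the kernel
    does.\<close>
  have "indicator {a<..<x} y *\<^sub>R (complex_of_real (x - y) powr (s - 1) * f y) =
      power_kernel s (x - y) * f y" for y
    using assms[of y] power_kernel_eq_powr[of "x - y" s]
    by (cases "y \<le> a"; cases "x \<le> y") auto
  then show ?thesis
    by (simp add: frac_int_def set_lebesgue_integral_def)
qed

text \<open>This lets the convolution form be applied to the outer operator in a
  composition.\<close>

lemma frac_int_eq_0: "x \<le> a \<Longrightarrow> frac_int a s f x = 0"
  by (simp add: frac_int_def set_lebesgue_integral_def)

lemma causal_space_borel_measurable:
  assumes "f \<in> causal_space a"
  shows "f \<in> borel_measurable borel"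
proof -
  have "continuous_on {a<..} f"
    using assms by (auto simp: causal_space_def intro: differentiable_imp_continuous_on)
  then have "(\<lambda>x. indicator {a<..} x *\<^sub>R f x) \<in> borel_measurable borel"
    by (intro borel_measurable_continuous_on_indicator) auto
  also have "(\<lambda>x. indicator {a<..} x *\<^sub>R f x) = f"
    using assms by (auto simp: causal_space_def fun_eq_iff indicator_def)
  finally show ?thesis .
qed

lemma integrable_power_kernel_causal:
  assumes f: "f \<in> causal_space a" and s: "0 < Re s" and "a < x"
  shows "integrable lborel (\<lambda>t. power_kernel s (x - t) * f t)"
proof -
  \<comment> \<open>The midpoint separates the two possible singularities: \<open>D\<close> bounds
    the kernel for \<open>t\<close> in \<open>{a..m}\<close>, \<open>B\<close> bounds
    \<open>f\<close> on \<open>{m..x}\<close>.\<close>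
  define m where "m = (a + x) / 2"
  have m: "a < m" "m < x"
    using \<open>a < x\<close> by (auto simp: m_def)
  note [measurable] = causal_space_borel_measurable[OF f]
  have "continuous_on {a<..} f"
    using f by (auto simp: causal_space_def intro: differentiable_imp_continuous_on)
  then have "continuous_on {m..x} f"
    by (rule continuous_on_subset) (use m in auto)
  then have "bounded (f ` {m..x})"
    by (intro compact_imp_bounded compact_continuous_image) auto
  then obtain B where "\<forall>z\<in>f ` {m..x}. norm z \<le> B"
    unfolding bounded_iff by blast
  then have B: "norm (f t) \<le> B" if "t \<in> {m..x}" for t
    using that by blast
  have "continuous_on {x - m..x - a} (\<lambda>u. u powr (Re s - 1))"
    using m by (intro continuous_intros) auto
  then have "bounded ((\<lambda>u. u powr (Re s - 1)) ` {x - m..x - a})"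
    by (intro compact_imp_bounded compact_continuous_image) auto
  then obtain D where "\<forall>z\<in>(\<lambda>u. u powr (Re s - 1)) ` {x - m..x - a}. norm z \<le> D"
    unfolding bounded_iff by blast
  then have D: "u powr (Re s - 1) \<le> D" if "u \<in> {x - m..x - a}" for u
    using that by fastforce
  have "integrable lborel (\<lambda>t. indicator {a<..<x} t *\<^sub>R f t)"
    using f \<open>a < x\<close> by (simp add: causal_space_def set_integrable_def)
  then have I1: "integrable lborel (\<lambda>t. D * norm (indicator {a<..<x} t *\<^sub>R f t))"
    by (intro integrable_mult_right integrable_norm)
  \<comment> \<open>\<open>power_kernel 1 (t - m)\<close> is the indicator of \<open>t > m\<close>,
    so the truncated kernel is a convolution integrand with second exponent 1.\<close>
  have I2: "integrable lborel
      (\<lambda>t. B * norm (power_kernel s (x - t) * power_kernel 1 (t - m)))"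
    using s by (intro integrable_mult_right integrable_norm integrable_power_kernel_conv) auto
  have "norm (f x) \<le> B" "(x - m) powr (Re s - 1) \<le> D"
    using m by (auto intro!: B D)
  then have nonneg: "0 \<le> B" "0 \<le> D"
    using norm_ge_zero[of "f x"] powr_ge_zero[of "x - m" "Re s - 1"] by linarith+
  show ?thesis
  proof (rule Bochner_Integration.integrable_bound)
    show "integrable lborel (\<lambda>t. D * norm (indicator {a<..<x} t *\<^sub>R f t) +
        B * norm (power_kernel s (x - t) * power_kernel 1 (t - m)))"
      using I1 I2 by (rule Bochner_Integration.integrable_add)
    have "norm (power_kernel s (x - t) * f t) \<le> D * norm (indicator {a<..<x} t *\<^sub>R f t) +
        B * norm (power_kernel s (x - t) * power_kernel 1 (t - m))" for t
    proof -
      consider "t \<le> a" | "x \<le> t" | "a < t" "t \<le> m" | "m < t" "t < x"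
        by linarith
      then show ?thesis
      proof cases
        case 1
        then have "f t = 0"
          using f by (simp add: causal_space_def)
        then show ?thesis
          using nonneg by simp
      next
        case 2
        then show ?thesis
          using nonneg by simp
      next
        case 3
        then have "norm (power_kernel s (x - t) * f t) \<le> D * norm (f t)"
          using D[of "x - t"] m by (auto simp: norm_mult norm_power_kernel intro!: mult_right_mono)
        then show ?thesis
          using 3 m by simp
      next
        case 4
        then have "norm (power_kernel s (x - t) * f t) \<le> B * norm (power_kernel s (x - t))"
          using B[of t] by (simp add: norm_mult mult_right_mono mult.commute)
        moreover have "0 \<le> D * norm (indicator {a<..<x} t *\<^sub>R f t)"
          using nonneg by simp
        ultimately show ?thesis
          using 4 by (simp add: power_kernel_1)
      qed
    qed
    then show "AE t in lborel. norm (power_kernel s (x - t) * f t) \<le>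
        norm (D * norm (indicator {a<..<x} t *\<^sub>R f t) +
          B * norm (power_kernel s (x - t) * power_kernel 1 (t - m)))"
      by (intro AE_I2) (metis abs_ge_self order_trans real_norm_def)
  qed measurable
qed

lemma frac_int_frac_int:
  assumes f: "f \<in> causal_space a" and s: "0 < Re s" and r: "0 < Re r" and "a < x"
  shows "frac_int a s (frac_int a r f) x = frac_int a (s + r) f x"
proof -
  have f0: "f y = 0" if "y \<le> a" for y
    using f that by (simp add: causal_space_def)
  have sr: "0 < Re (s + r)"
    using s r by simp
  have "frac_int a s (frac_int a r f) x =
      1 / Gamma s * (LBINT y. power_kernel s (x - y) * frac_int a r f y)"
    by (intro frac_int_eq_power_kernel frac_int_eq_0)
  also have "\<dots> = 1 / (Gamma s * Gamma r) *
      (LBINT y. power_kernel s (x - y) * (LBINT t. power_kernel r (y - t) * f t))"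
    by (simp add: frac_int_eq_power_kernel[OF f0])
  also have "\<dots> = 1 / (Gamma s * Gamma r) * (Beta s r *
      (LBINT t. power_kernel (s + r) (x - t) * f t))"
    using power_kernel_conv_assoc[OF s r causal_space_borel_measurable[OF f]
        integrable_power_kernel_causal[OF f sr \<open>a < x\<close>]]
    by (simp add: lborel_integral_power_kernel_beta[OF s r])
  \<comment> \<open>The numerator of \<open>Beta s r\<close> cancels both normalising factors and
    leaves \<open>1 / Gamma (s + r)\<close>.\<close>
  also have "\<dots> = frac_int a (s + r) f x"
    using Gamma_nonzero_Re_pos[OF s] Gamma_nonzero_Re_pos[OF r]
    by (simp add: frac_int_eq_power_kernel[OF f0] Beta_def)
  finally show ?thesis .
qed

theorem theorem2:
  fixes a :: real and s1 s2 :: complex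
  assumes "Re s1 > 0" and "Re s2 > 0"
  shows "\<forall>f\<in>causal_space a. \<forall>x>a.
           frac_int a s1 (frac_int a s2 f) x = frac_int a (s1 + s2) f x \<and>
           frac_int a (s1 + s2) f x = frac_int a s2 (frac_int a s1 f) x"
proof (intro ballI allI impI)
  fix f x
  assume "f \<in> causal_space a" "a < x"
  then show "frac_int a s1 (frac_int a s2 f) x = frac_int a (s1 + s2) f x \<and>
      frac_int a (s1 + s2) f x = frac_int a s2 (frac_int a s1 f) x"
    \<comment> \<open>Both orders of composition yield the order \<open>s1 + s2\<close>, since
      addition commutes.\<close>
    using frac_int_frac_int[of f a s1 s2 x] frac_int_frac_int[of f a s2 s1 x] assms
    by (simp only: add.commute[of s2 s1] simp_thms)
qed

end
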